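(* Let $\Sigma$ be a relational schema, $q$ a Boolean conjunctive query over $\Sigma$, $D$ a database over $\Sigma$, and $\mu \in \mathit{sub}(q,D)$. If there exists a redundant (w.r.t. $q$) key component $K$ of $D$ such that $\mu(q) \cap K \neq \emptyset$, then $\mu$ is unfounded.
   Context: Fix disjoint countably infinite sets $\mathbf{C}$ (constants) and $\mathbf{V}$ (variables). A relational schema is a triple $\Sigma=\langle \mathcal{R},\alpha,\kappa\rangle$ with $\mathcal{R}$ a finite set of relation symbols, $\alpha:\mathcal{R}\to\mathbb{N}$ giving arities, and $\kappa$ assigning to each $r\in\mathcal{R}$ a nonempty set $\kappa(r)\subseteq\{1,\ldots,\alpha(r)\}$ (the primary key positions). An atom is $r(t_1,\ldots,t_{\alpha(r)})$ with terms $t_i\in\mathbf{C}\cup\mathbf{V}$; it is a fact if all terms are constants. A database is a finite set of facts. For an atom $r(\mathbf{t})$, $\hat{\mathbf{t}}$ is the subsequence of $\mathbf{t}$ at the positions in $\kappa(r)$. A database is inconsistent if it contains two different facts $r(\mathbf{t}_1),r(\mathbf{t}_2)$ with $\hat{\mathbf{t}}_1=\hat{\mathbf{t}}_2$; otherwise it is consistent. A repair of $D$ is a maximal (w.r.t. inclusion) consistent subset of $D$; $\mathit{rep}(D,\Sigma)$ is the set of all repairs of $D$. A substitution is a map $\mu:\mathbf{C}\cup\mathbf{V}\to\mathbf{C}\cup\mathbf{V}$ that is the identity on $\mathbf{C}$, extended to (sets of) atoms termwise. A Boolean conjunctive query (BCQ) $q$ is an existentially closed conjunction of atoms (possibly with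 constants), identified with the set of its atoms. $q$ is true in a database $R$ if $\mu(q)\subseteq R$ for some substitution $\mu$. $D\models_\Sigma q$ ("$q$ is consistently true in $D$") means that $q$ is true in every repair of $D$. Let $\mathit{var}(q)$ be the set of variables of $q$ and $\mathit{sub}(q,D)=\{\mu|_{\mathit{var}(q)} : \mu \text{ is a substitution and } \mu(q)\subseteq D\}$. A key component of $D$ is a maximal subset $K\subseteq D$ such that any two facts $r_1(\mathbf{t}_1),r_2(\mathbf{t}_2)\in K$ satisfy $r_1=r_2$ and $\hat{\mathbf{t}}_1=\hat{\mathbf{t}}_2$; the set of all key components of $D$ is denoted $\mathit{comp}(D,\Sigma)$. A fragment of $D$ is any set of the form $\bigcup_{K\in C}K$ with $C\subseteq \mathit{comp}(D,\Sigma)$. A key component $K$ of $D$ is redundant (w.r.t. $q$) if for each fragment $F$ of $D$, $F\models_\Sigma q$ implies $F\setminus K\models_\Sigma q$. A substitution $\mu\in\mathit{sub}(q,D)$ is unfounded if: for each fragment $F$ of $D$, $F\models_\Sigma q$ implies that, for each repair $R\in\mathit{rep}(F,\Sigma)$, there exists a substitution $\mu'\in\mathit{sub}(q,R)$ different from $\mu$ such that $\mu'(q)\subseteq R$. *)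

theory Defs
  imports Main "HOL-Library.FuncSet" "HOL-Library.Countable" "HOL-Library.Infinite_Typeclass"
begin

record 'r schema =
  rels :: "'r set"
  arity :: "'r \<Rightarrow> nat"
  keypos :: "'r \<Rightarrow> nat set"

definition relational_schema :: "'r schema \<Rightarrow> bool" where
  "relational_schema \<Sigma> \<longleftrightarrow>
     finite (rels \<Sigma>) \<and>
     (\<forall>r\<in>rels \<Sigma>. keypos \<Sigma> r \<noteq> {} \<and> keypos \<Sigma> r \<subseteq> {1..arity \<Sigma> r})"

datatype ('c, 'v) trm = Const 'c | Var 'v

datatype ('r, 'c, 'v) atom = Atom (rel: 'r) (args: "('c, 'v) trm list")

definition atom_over :: "'r schema \<Rightarrow> ('r, 'c, 'v) atom \<Rightarrow> bool" where
  "atom_over \<Sigma> a \<longleftrightarrow> rel a \<in> rels \<Sigma> \<and> length (args a) = arity \<Sigma> (rel a)"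

definition is_fact :: "('r, 'c, 'v) atom \<Rightarrow> bool" where
  "is_fact a \<longleftrightarrow> set (args a) \<subseteq> range Const"

definition database :: "'r schema \<Rightarrow> ('r, 'c, 'v) atom set \<Rightarrow> bool" where
  "database \<Sigma> D \<longleftrightarrow> finite D \<and> (\<forall>a\<in>D. atom_over \<Sigma> a \<and> is_fact a)"

definition bcq :: "'r schema \<Rightarrow> ('r, 'c, 'v) atom set \<Rightarrow> bool" where
  "bcq \<Sigma> q \<longleftrightarrow> finite q \<and> (\<forall>a\<in>q. atom_over \<Sigma> a)"

text \<open>Key positions are counted from 1, list positions from 0.\<close>

definition key :: "'r schema \<Rightarrow> ('r, 'c, 'v) atom \<Rightarrow> ('c, 'v) trm list" where
  "key \<Sigma> a = nths (args a) {i. Suc i \<in> keypos \<Sigma> (rel a)}"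

definition consistent :: "'r schema \<Rightarrow> ('r, 'c, 'v) atom set \<Rightarrow> bool" where
  "consistent \<Sigma> D \<longleftrightarrow>
     \<not> (\<exists>a\<in>D. \<exists>b\<in>D. a \<noteq> b \<and> rel a = rel b \<and> key \<Sigma> a = key \<Sigma> b)"

definition rep :: "'r schema \<Rightarrow> ('r, 'c, 'v) atom set \<Rightarrow> ('r, 'c, 'v) atom set set" where
  "rep \<Sigma> D = {R. R \<subseteq> D \<and> consistent \<Sigma> R \<and>
                  (\<forall>S. S \<subseteq> D \<and> consistent \<Sigma> S \<and> R \<subseteq> S \<longrightarrow> S = R)}"

text \<open>A map on all terms that is the identity on constants is determined by an arbitrary
  map from variables to terms, so substitutions are represented by the latter.\<close>

type_synonym ('c, 'v) subst = "'v \<Rightarrow> ('c, 'v) trm"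

fun subst_trm :: "('c, 'v) subst \<Rightarrow> ('c, 'v) trm \<Rightarrow> ('c, 'v) trm" where
  "subst_trm \<mu> (Const c) = Const c"
| "subst_trm \<mu> (Var x) = \<mu> x"

definition subst_atom :: "('c, 'v) subst \<Rightarrow> ('r, 'c, 'v) atom \<Rightarrow> ('r, 'c, 'v) atom" where
  "subst_atom \<mu> a = Atom (rel a) (map (subst_trm \<mu>) (args a))"

definition subst_atoms :: "('c, 'v) subst \<Rightarrow> ('r, 'c, 'v) atom set \<Rightarrow> ('r, 'c, 'v) atom set" where
  "subst_atoms \<mu> q = subst_atom \<mu> ` q"

definition var :: "('r, 'c, 'v) atom set \<Rightarrow> 'v set" where
  "var q = {x. \<exists>a\<in>q. Var x \<in> set (args a)}"

definition true_in :: "('r, 'c, 'v) atom set \<Rightarrow> ('r, 'c, 'v) atom set \<Rightarrow> bool" where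
  "true_in q R \<longleftrightarrow> (\<exists>\<mu>. subst_atoms \<mu> q \<subseteq> R)"

definition consistently_true ::
    "'r schema \<Rightarrow> ('r, 'c, 'v) atom set \<Rightarrow> ('r, 'c, 'v) atom set \<Rightarrow> bool" where
  "consistently_true \<Sigma> D q \<longleftrightarrow> (\<forall>R\<in>rep \<Sigma> D. true_in q R)"

text \<open>Elements of \<open>sub q D\<close> are \<open>undefined\<close> outside \<open>var q\<close>, so two of them are equal
  iff they agree on \<open>var q\<close>; applying one to \<open>q\<close> never uses its values elsewhere.\<close>

definition sub :: "('r, 'c, 'v) atom set \<Rightarrow> ('r, 'c, 'v) atom set \<Rightarrow> ('c, 'v) subst set" where
  "sub q D = {restrict \<mu> (var q) | \<mu>. subst_atoms \<mu> q \<subseteq> D}"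

definition key_equal :: "'r schema \<Rightarrow> ('r, 'c, 'v) atom set \<Rightarrow> bool" where
  "key_equal \<Sigma> K \<longleftrightarrow> (\<forall>a\<in>K. \<forall>b\<in>K. rel a = rel b \<and> key \<Sigma> a = key \<Sigma> b)"

definition key_components :: "'r schema \<Rightarrow> ('r, 'c, 'v) atom set \<Rightarrow> ('r, 'c, 'v) atom set set" where
  "key_components \<Sigma> D = {K. K \<subseteq> D \<and> key_equal \<Sigma> K \<and>
                   (\<forall>L. L \<subseteq> D \<and> key_equal \<Sigma> L \<and> K \<subseteq> L \<longrightarrow> L = K)}"

definition fragment :: "'r schema \<Rightarrow> ('r, 'c, 'v) atom set \<Rightarrow> ('r, 'c, 'v) atom set \<Rightarrow> bool" where
  "fragment \<Sigma> D F \<longleftrightarrow> (\<exists>C \<subseteq> key_components \<Sigma> D. F = \<Union>C)"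

definition redundant ::
    "'r schema \<Rightarrow> ('r, 'c, 'v) atom set \<Rightarrow> ('r, 'c, 'v) atom set \<Rightarrow> ('r, 'c, 'v) atom set \<Rightarrow> bool"
where
  "redundant \<Sigma> q D K \<longleftrightarrow>
     (\<forall>F. fragment \<Sigma> D F \<longrightarrow> consistently_true \<Sigma> F q \<longrightarrow> consistently_true \<Sigma> (F - K) q)"

definition unfounded ::
    "'r schema \<Rightarrow> ('r, 'c, 'v) atom set \<Rightarrow> ('r, 'c, 'v) atom set \<Rightarrow> ('c, 'v) subst \<Rightarrow> bool"
where
  "unfounded \<Sigma> q D \<mu> \<longleftrightarrow>
     (\<forall>F. fragment \<Sigma> D F \<longrightarrow> consistently_true \<Sigma> F q \<longrightarrow>
        (\<forall>R\<in>rep \<Sigma> F. \<exists>\<mu>'\<in>sub q R. \<mu>' \<noteq> \<mu> \<and> subst_atoms \<mu>' q \<subseteq> R))"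

end

theory Submission
  imports Defs
begin

text \<open>Removing the key component \<open>K\<close> from a fragment \<open>F\<close> turns each repair \<open>R\<close> of \<open>F\<close> into the
  repair \<open>R - K\<close> of \<open>F - K\<close>, because no fact outside \<open>K\<close> conflicts with a fact of \<open>K\<close>. If \<open>K\<close> is
  redundant and \<open>q\<close> is consistently true in \<open>F\<close>, then \<open>q\<close> is satisfied in \<open>R - K\<close>, and any
  substitution witnessing this differs from one whose image of \<open>q\<close> meets \<open>K\<close>.\<close>

lemma key_component_closed:
  assumes K: "K \<in> key_components \<Sigma> D" and "b \<in> K" and "a \<in> D"
    and "rel a = rel b" and "key \<Sigma> a = key \<Sigma> b"
  shows "a \<in> K"
proof -
  have "K \<subseteq> D" and "key_equal \<Sigma> K"
    using K unfolding key_components_def by blast+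
  \<comment> \<open>Every fact of \<open>K\<close> agrees with \<open>b\<close>, hence with
    \<open>a\<close>, on relation and key, so \<open>a\<close> can join \<open>K\<close>; maximality
    of \<open>K\<close> then forces \<open>a\<close> to be in it already.\<close>
  then have "insert a K \<subseteq> D" and "key_equal \<Sigma> (insert a K)"
    using assms(2-5) unfolding key_equal_def by (blast, metis insert_iff)
  then have "insert a K = K"
    using K unfolding key_components_def by blast
  then show ?thesis by blast
qed

lemma fragment_subset: "fragment \<Sigma> D F \<Longrightarrow> F \<subseteq> D"
  unfolding fragment_def key_components_def by blast

lemma consistent_subset: "consistent \<Sigma> S \<Longrightarrow> R \<subseteq> S \<Longrightarrow> consistent \<Sigma> R"
  unfolding consistent_def by blast

text \<open>Maximality is transferred from \<open>R\<close>: a consistent \<open>S\<close> between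
  \<open>R - K\<close> and \<open>F - K\<close> is enlarged by \<open>R \<inter> K\<close> to a
  consistent subset of \<open>F\<close> containing \<open>R\<close>, which must be \<open>R\<close>
  itself.\<close>

lemma rep_Diff_key_component:
  assumes K: "K \<in> key_components \<Sigma> D" and "F \<subseteq> D" and R: "R \<in> rep \<Sigma> F"
  shows "R - K \<in> rep \<Sigma> (F - K)"
proof -
  have RF: "R \<subseteq> F" and R_cons: "consistent \<Sigma> R"
    using R unfolding rep_def by blast+
  have "S = R - K" if S: "S \<subseteq> F - K" "consistent \<Sigma> S" "R - K \<subseteq> S" for S
  proof -
    \<comment> \<open>A conflict with a fact of \<open>K\<close> would put \<open>a\<close> into
      \<open>K\<close>, which \<open>S\<close> avoids.\<close>
    have no_conflict: "rel a \<noteq> rel b \<or> key \<Sigma> a \<noteq> key \<Sigma> b" if "a \<in> S" "b \<in> R \<inter> K" for a b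
      using key_component_closed[OF K, of b a] that S(1) \<open>F \<subseteq> D\<close> by blast
    have "consistent \<Sigma> (S \<union> (R \<inter> K))"
      unfolding consistent_def
    proof (intro notI, elim bexE conjE)
      fix a b
      assume "a \<in> S \<union> (R \<inter> K)" "b \<in> S \<union> (R \<inter> K)"
        and ab: "a \<noteq> b" "rel a = rel b" "key \<Sigma> a = key \<Sigma> b"
      then consider "a \<in> S" "b \<in> S" | "a \<in> R" "b \<in> R"
        | "a \<in> S" "b \<in> R \<inter> K" | "b \<in> S" "a \<in> R \<inter> K"
        by blast
      then show False
      proof cases
        case 1 then show ?thesis using S(2) ab unfolding consistent_def by blast
      next
        case 2 then show ?thesis using R_cons ab unfolding consistent_def by blast
      next
        case 3 then show ?thesis using no_conflict ab by blast
      next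
        case 4 then show ?thesis using no_conflict[of b a] ab by simp
      qed
    qed
    moreover have "S \<union> (R \<inter> K) \<subseteq> F" and "R \<subseteq> S \<union> (R \<inter> K)"
      using S RF by auto
    ultimately have "S \<union> (R \<inter> K) = R"
      using R unfolding rep_def by blast
    then show ?thesis
      using S(1) by blast
  qed
  then show ?thesis
    using RF consistent_subset[OF R_cons, of "R - K"] unfolding rep_def by blast
qed

text \<open>Allows an arbitrary substitution making \<open>q\<close> true to be replaced by its
  normalized form in \<open>sub\<close>.\<close>

lemma subst_atoms_restrict_var: "subst_atoms (restrict \<mu> (var q)) q = subst_atoms \<mu> q"
proof -
  have "subst_trm (restrict \<mu> (var q)) t = subst_trm \<mu> t" if "a \<in> q" "t \<in> set (args a)" for a t
    using that by (cases t) (auto simp: var_def)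
  then show ?thesis
    by (auto simp: subst_atoms_def subst_atom_def intro!: image_cong)
qed

theorem theorem3:
  fixes \<Sigma> :: "'r schema"
    and q D :: "('r, 'c::{countable,infinite}, 'v::{countable,infinite}) atom set"
    and \<mu> :: "('c, 'v) subst"
  assumes "relational_schema \<Sigma>"
    and "bcq \<Sigma> q"
    and "database \<Sigma> D"
    and "\<mu> \<in> sub q D"
    and "\<exists>K\<in>key_components \<Sigma> D. redundant \<Sigma> q D K \<and> subst_atoms \<mu> q \<inter> K \<noteq> {}"
  shows "unfounded \<Sigma> q D \<mu>"
proof -
  obtain K where K: "K \<in> key_components \<Sigma> D" "redundant \<Sigma> q D K" "subst_atoms \<mu> q \<inter> K \<noteq> {}"
    using assms(5) by blast
  have "\<exists>\<mu>'\<in>sub q R. \<mu>' \<noteq> \<mu> \<and> subst_atoms \<mu>' q \<subseteq> R"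
    if F: "fragment \<Sigma> D F" "consistently_true \<Sigma> F q" and R: "R \<in> rep \<Sigma> F" for F R
  proof -
    have "consistently_true \<Sigma> (F - K) q"
      using K(2) F by (simp add: redundant_def)
    moreover have "R - K \<in> rep \<Sigma> (F - K)"
      using rep_Diff_key_component[OF K(1) fragment_subset[OF F(1)] R] .
    ultimately obtain \<nu> where \<nu>: "subst_atoms \<nu> q \<subseteq> R - K"
      unfolding consistently_true_def true_in_def by blast
    let ?\<mu>' = "restrict \<nu> (var q)"
    have sub: "subst_atoms ?\<mu>' q \<subseteq> R - K"
      using \<nu> by (simp only: subst_atoms_restrict_var)
    have "?\<mu>' \<in> sub q R"
      using \<nu> unfolding sub_def by blast
    \<comment> \<open>The image of \<open>q\<close> under \<open>\<mu>\<close> meets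
      \<open>K\<close>, while the image under \<open>?\<mu>'\<close> avoids it.\<close>
    moreover have "?\<mu>' \<noteq> \<mu>"
      using sub K(3) by blast
    ultimately show ?thesis
      using sub by blast
  qed
  then show ?thesis
    by (simp add: unfounded_def)
qed

end
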